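(* Let $n$ be a positive integer and let $k,m$ be positive integers with $k,m\le n$. The number of connected endofunctions on $[n]$ of girth $m$ having at least $k+1$ records equals the number of connected endofunctions on $[n]$ of girth $m+1$ having at least $k$ records.
   Context: An endofunction on $[n]=\{1,\dots,n\}$ is a map $f:[n]\to[n]$; its functional graph is the directed graph on $[n]$ with edges $(i,f(i))$. It is connected if its functional graph is connected ignoring orientations, and its girth is then the number of edges of the unique cycle of its functional graph. The orbit of $i\in[n]$ is $\{f^j(i): j\ge 0\}$. An element $i\in[n]$ is a record of $f$ if $i$ is greater than or equal to every element of its orbit. *)

theory Defs
  imports "Graph_Theory.Pair_Digraph" "Graph_Theory.Digraph_Component" "HOL-Library.FuncSet"
begin

text \<open>Endofunctions on \<open>[n]\<close> are extensional functions, so that distinct elements of this set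
  are distinct maps on \<open>{1..n}\<close> and cardinalities count each map exactly once.\<close>

definition endofunctions :: "nat \<Rightarrow> (nat \<Rightarrow> nat) set" where
  "endofunctions n = {1..n} \<rightarrow>\<^sub>E {1..n}"

definition functional_graph :: "nat \<Rightarrow> (nat \<Rightarrow> nat) \<Rightarrow> nat pair_pre_digraph" where
  "functional_graph n f = \<lparr> pverts = {1..n}, parcs = {(i, f i) | i. i \<in> {1..n}} \<rparr>"

text \<open>\<^const>\<open>Digraph_Component.connected\<close> is connectedness ignoring orientations (strong
  connectedness of the symmetric closure).\<close>

definition connected_endofunctions :: "nat \<Rightarrow> (nat \<Rightarrow> nat) set" where
  "connected_endofunctions n =
     {f \<in> endofunctions n. Digraph_Component.connected (with_proj (functional_graph n f))}"

text \<open>In the library a cycle is a closed walk with a chosen starting vertex (loops are cycles of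
  length one), so it is unique only up to rotation. What is unique is its set of edges; the
  description below is meaningful for connected endofunctions, which is where it is used.\<close>

definition cycle_edges :: "nat \<Rightarrow> (nat \<Rightarrow> nat) \<Rightarrow> (nat \<times> nat) set" where
  "cycle_edges n f =
     (THE C. \<exists>p. pre_digraph.cycle (with_proj (functional_graph n f)) p \<and> C = set p)"

definition endofunction_girth :: "nat \<Rightarrow> (nat \<Rightarrow> nat) \<Rightarrow> nat" where
  "endofunction_girth n f = card (cycle_edges n f)"

definition orbit_of :: "(nat \<Rightarrow> nat) \<Rightarrow> nat \<Rightarrow> nat set" where
  "orbit_of f i = {(f ^^ j) i | j. j \<ge> 0}"

definition records :: "nat \<Rightarrow> (nat \<Rightarrow> nat) \<Rightarrow> nat set" where
  "records n f = {i \<in> {1..n}. \<forall>x \<in> orbit_of f i. x \<le> i}"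

end

theory Submission
  imports Defs "HOL-Combinatorics.Transposition"
begin

text \<open>Both sides count pairs \<open>(g, r)\<close> of a connected endofunction \<open>g\<close> of girth \<open>m\<close> and a record \<open>r\<close>
  of \<open>g\<close> off the cycle, with at least \<open>k\<close> records that are \<open>\<ge> r\<close>.

  If \<open>f\<close> has girth \<open>m + 1\<close>, let \<open>r\<close> be the maximum of its cycle (its smallest record) and short-cut the
  cycle past \<open>r\<close>. This gives exactly the pairs in which \<open>g r\<close> lies on the cycle of \<open>g\<close>, and the
  records of \<open>f\<close> are the records of \<open>g\<close> that are \<open>\<ge> r\<close>.

  If \<open>f\<close> has girth \<open>m\<close>, let \<open>r\<close> be its second smallest record, the smallest one off the cycle. With
  \<open>S\<close> the set of points whose orbit stays below \<open>r\<close>, this gives exactly the pairs in which the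
  maximum of \<open>S\<close> lies on the cycle.

  Relabelling \<open>g\<close> inside \<open>S\<close> by the transposition of \<open>g r\<close> and \<open>Max S\<close>, and keeping all other
  values (including \<open>g r\<close>), is an involution that exchanges the two kinds of pairs.\<close>

section \<open>Orbits\<close>

lemma orbit_of_self [simp]: "x \<in> orbit_of f x"
  unfolding orbit_of_def by (auto intro: exI[of _ 0])

lemma orbit_of_step: "y \<in> orbit_of f x \<Longrightarrow> f y \<in> orbit_of f x"
  unfolding orbit_of_def by (auto intro: exI[of _ "Suc _"])

lemma orbit_of_induct [consumes 1, case_names self step]:
  assumes "y \<in> orbit_of f x" and "P x"
    and "\<And>z. z \<in> orbit_of f x \<Longrightarrow> P z \<Longrightarrow> P (f z)"
  shows "P y"
proof -
  have "P ((f ^^ j) x)" for j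
    by (induction j) (use assms(2,3) in \<open>auto simp: orbit_of_def\<close>)
  then show ?thesis using assms(1) by (auto simp: orbit_of_def)
qed

text \<open>The orbit is the least \<open>f\<close>-closed set containing \<open>x\<close>. Orbits
  of modified maps are compared below by exhibiting a closed set.\<close>

lemma orbit_of_least:
  assumes "x \<in> A" and "\<And>z. z \<in> A \<Longrightarrow> f z \<in> A"
  shows "orbit_of f x \<subseteq> A"
proof
  fix y assume "y \<in> orbit_of f x"
  then show "y \<in> A" by (induction rule: orbit_of_induct) (use assms in auto)
qed

lemma orbit_of_subset: "y \<in> orbit_of f x \<Longrightarrow> orbit_of f y \<subseteq> orbit_of f x"
  by (rule orbit_of_least) (auto intro: orbit_of_step)

lemma orbit_of_unfold: "orbit_of f x = insert x (orbit_of f (f x))"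
proof
  show "orbit_of f x \<subseteq> insert x (orbit_of f (f x))"
    by (rule orbit_of_least) (auto intro: orbit_of_step)
  show "insert x (orbit_of f (f x)) \<subseteq> orbit_of f x"
    using orbit_of_subset[OF orbit_of_step[OF orbit_of_self]] by auto
qed

text \<open>Stepping on from \<open>z\<close> keeps a way back to \<open>x\<close>: if
  \<open>z = x\<close>, periodicity supplies it; otherwise the known way back already passes through
  \<open>f z\<close>.\<close>

lemma orbit_of_back:
  assumes "x \<in> orbit_of f (f x)" and "z \<in> orbit_of f x"
  shows "x \<in> orbit_of f z"
  using assms(2)
proof (induction rule: orbit_of_induct)
  case (step z)
  then show ?case using assms(1) orbit_of_unfold[of f z] by auto
qed simp

lemma orbit_of_preimage:
  assumes "y \<in> orbit_of f x" "y \<noteq> x"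
  obtains z where "z \<in> orbit_of f x" "f z = y"
  using assms by (induction rule: orbit_of_induct) auto

lemma endofunctions_range: "f \<in> endofunctions n \<Longrightarrow> x \<in> {1..n} \<Longrightarrow> f x \<in> {1..n}"
  unfolding endofunctions_def by auto

lemma endofunctions_orbit:
  "f \<in> endofunctions n \<Longrightarrow> x \<in> {1..n} \<Longrightarrow> orbit_of f x \<subseteq> {1..n}"
  by (rule orbit_of_least) (auto dest: endofunctions_range)

lemma endofunctions_upd:
  "f \<in> endofunctions n \<Longrightarrow> p \<in> {1..n} \<Longrightarrow> q \<in> {1..n} \<Longrightarrow> f(p := q) \<in> endofunctions n"
  unfolding endofunctions_def by (auto simp: PiE_def extensional_def)

section \<open>Cycle points and records\<close>

text \<open>For an endofunction of a nonempty set this is empty exactly when the functional graph is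
  disconnected; otherwise it is the vertex set of the unique cycle.\<close>

definition cycle_points :: "nat \<Rightarrow> (nat \<Rightarrow> nat) \<Rightarrow> nat set" where
  "cycle_points n f = {c \<in> {1..n}. \<forall>x \<in> {1..n}. c \<in> orbit_of f x}"

lemma cycle_points_subset: "cycle_points n f \<subseteq> {1..n}"
  unfolding cycle_points_def by auto

lemma finite_cycle_points [simp]: "finite (cycle_points n f)"
  using cycle_points_subset finite_subset by blast

lemma finite_records [simp]: "finite (records n f)"
  unfolding records_def by auto

lemma cycle_points_orbit: "c \<in> cycle_points n f \<Longrightarrow> x \<in> {1..n} \<Longrightarrow> c \<in> orbit_of f x"
  unfolding cycle_points_def by auto

lemma cycle_points_step:
  assumes "f \<in> endofunctions n" "c \<in> cycle_points n f"
  shows "f c \<in> cycle_points n f"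
  using assms endofunctions_range[OF assms(1)] orbit_of_step unfolding cycle_points_def by auto

lemma orbit_of_cycle_point:
  assumes "f \<in> endofunctions n" "c \<in> cycle_points n f"
  shows "orbit_of f c = cycle_points n f"
proof
  show "orbit_of f c \<subseteq> cycle_points n f"
    by (rule orbit_of_least) (use assms cycle_points_step in auto)
  show "cycle_points n f \<subseteq> orbit_of f c"
    using assms(2) cycle_points_subset cycle_points_orbit by blast
qed

lemma cycle_points_subset_orbit:
  "x \<in> {1..n} \<Longrightarrow> cycle_points n f \<subseteq> orbit_of f x"
  using cycle_points_orbit by blast

text \<open>One point reached from everywhere determines the cycle; the cycles of modified maps are
  computed this way.\<close>

lemma cycle_points_eq:
  assumes "f \<in> endofunctions n" "c \<in> {1..n}" "\<And>x. x \<in> {1..n} \<Longrightarrow> c \<in> orbit_of f x"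
  shows "cycle_points n f = orbit_of f c"
  using orbit_of_cycle_point[OF assms(1), of c] assms(2,3) unfolding cycle_points_def by auto

text \<open>A cycle point \<open>c\<close> lies in the orbit of \<open>x\<close>, and a periodic
  \<open>x\<close> is reached again from every point of its orbit, hence from
  \<open>c\<close>.\<close>

lemma cycle_point_if_periodic:
  assumes "f \<in> endofunctions n" "cycle_points n f \<noteq> {}" "x \<in> {1..n}" "x \<in> orbit_of f (f x)"
  shows "x \<in> cycle_points n f"
proof -
  obtain c where c: "c \<in> cycle_points n f" using assms(2) by auto
  have "x \<in> orbit_of f c"
    using orbit_of_back[OF assms(4)] cycle_points_orbit[OF c assms(3)] by blast
  then show ?thesis using orbit_of_cycle_point[OF assms(1) c] by simp
qed

text \<open>The orbit of \<open>f c\<close> is the whole cycle, so \<open>c\<close> has a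
  predecessor on it; a surjection of a finite set onto itself is injective.\<close>

lemma bij_betw_cycle_points:
  assumes f: "f \<in> endofunctions n"
  shows "bij_betw f (cycle_points n f) (cycle_points n f)"
proof -
  have "c \<in> f ` cycle_points n f" if c: "c \<in> cycle_points n f" for c
  proof (cases "f c = c")
    case True
    then show ?thesis using c by force
  next
    case False
    have *: "orbit_of f (f c) = cycle_points n f"
      using orbit_of_cycle_point[OF f] cycle_points_step[OF f c] by blast
    then obtain z where "z \<in> orbit_of f (f c)" "f z = c"
      using orbit_of_preimage[of c f "f c"] c False by metis
    then show ?thesis using * by auto
  qed
  then have "f ` cycle_points n f = cycle_points n f"
    using cycle_points_step[OF f] by auto
  then show ?thesis
    by (simp add: bij_betw_def eq_card_imp_inj_on)
qed

lemma cycle_pred: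
  assumes f: "f \<in> endofunctions n" and c: "c \<in> cycle_points n f"
  shows "inv_into (cycle_points n f) f c \<in> cycle_points n f"
    and "f (inv_into (cycle_points n f) f c) = c"
  using bij_betw_cycle_points[OF f] c
  by (auto simp: bij_betw_def intro: inv_into_into f_inv_into_f)

lemma cycle_pred_eq:
  assumes f: "f \<in> endofunctions n" and c: "p \<in> cycle_points n f" "f p = c"
  shows "inv_into (cycle_points n f) f c = p"
  using bij_betw_cycle_points[OF f] c by (auto simp: bij_betw_def inv_into_f_f)

lemma record_le: "r \<in> records n f \<Longrightarrow> x \<in> orbit_of f r \<Longrightarrow> x \<le> r"
  unfolding records_def by auto

lemma recordI: "r \<in> {1..n} \<Longrightarrow> (\<And>x. x \<in> orbit_of f r \<Longrightarrow> x \<le> r) \<Longrightarrow> r \<in> records n f"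
  unfolding records_def by auto

lemma records_subset: "records n f \<subseteq> {1..n}"
  unfolding records_def by auto

section \<open>Splicing a record into the cycle\<close>

text \<open>A path of \<open>f\<close> is also a path of the updated map until it first leaves
  \<open>p\<close>.\<close>

lemma orbit_of_fun_upd:
  assumes "z \<in> orbit_of f x"
  shows "z \<in> orbit_of (f(p := w)) x \<or> p \<in> orbit_of (f(p := w)) x"
proof -
  let ?h = "f(p := w)"
  show ?thesis using assms
  proof (induction rule: orbit_of_induct)
    case (step z)
    have "?h z \<in> orbit_of ?h x" if "z \<in> orbit_of ?h x" using that by (rule orbit_of_step)
    moreover have "?h z = f z" if "z \<noteq> p" using that by simp
    ultimately show ?case using step.IH by metis
  qed simp
qed

text \<open>The cycle edge \<open>p -> g r\<close> becomes the detour \<open>p -> r -> g r\<close>,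
  so each orbit in \<open>[n]\<close> is replaced by its union with \<open>{r}\<close>. A point
  therefore stays a record exactly when it is at least \<open>r\<close>, and no new records
  arise.\<close>

lemma splice_record:
  assumes g: "g \<in> endofunctions n" and r: "r \<in> records n g - cycle_points n g"
    and y: "g r \<in> cycle_points n g" and p: "p \<in> cycle_points n g" "g p = g r"
  defines "f \<equiv> g(p := r)"
  shows "f \<in> endofunctions n" "cycle_points n f = insert r (cycle_points n g)"
    "records n f = {q \<in> records n g. r \<le> q}"
proof -
  let ?C = "cycle_points n g"
  have rV: "r \<in> {1..n}" using r records_subset by blast
  have pV: "p \<in> {1..n}" using p cycle_points_subset by blast
  have pr: "p \<noteq> r" using p r by auto
  have fE: "f \<in> endofunctions n" unfolding f_def using g pV rV by (rule endofunctions_upd)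
  have fp: "f p = r" and fr: "f r = g r" and fx: "\<And>x. x \<noteq> p \<Longrightarrow> f x = g x"
    using pr by (auto simp: f_def)
  have reach: "r \<in> orbit_of f x" if "x \<in> {1..n}" for x
  proof -
    have "p \<in> orbit_of f x"
      using orbit_of_fun_upd[OF cycle_points_orbit[OF p(1) that]] unfolding f_def by blast
    then show ?thesis using orbit_of_step fp by metis
  qed
  then have Cf: "cycle_points n f = orbit_of f r"
    using cycle_points_eq[OF fE rV] by blast
  have "orbit_of f r \<subseteq> insert r ?C"
    by (rule orbit_of_least) (use fp fr fx y cycle_points_step[OF g] in \<open>auto simp: f_def\<close>)
  moreover have "?C \<subseteq> orbit_of f r"
  proof -
    have y': "g r \<in> orbit_of f r" using orbit_of_step[OF orbit_of_self, of f r] fr by simp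
    have "g z \<in> orbit_of f r" if "z \<in> orbit_of f r" for z
      using that y' orbit_of_step[of z f r] fx[of z] p(2) by (cases "z = p") auto
    then have "orbit_of g (g r) \<subseteq> orbit_of f r" using y' by (intro orbit_of_least)
    then show ?thesis using orbit_of_cycle_point[OF g y] by simp
  qed
  ultimately show C: "cycle_points n f = insert r ?C" using Cf by auto
  have "q \<in> records n f \<longleftrightarrow> q \<in> records n g \<and> r \<le> q" for q
  proof (cases "q \<in> {1..n}")
    case q: True
    have sub: "cycle_points n f \<subseteq> orbit_of f q" by (rule cycle_points_subset_orbit[OF q])
    have "g z \<in> orbit_of f q" if "z \<in> orbit_of f q" for z
      using that sub C y orbit_of_step[of z f q] fx[of z] p(2) by (cases "z = p") auto
    then have 1: "orbit_of g q \<subseteq> orbit_of f q" by (intro orbit_of_least) auto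
    have "?C \<subseteq> orbit_of g q" by (rule cycle_points_subset_orbit[OF q])
    then have "f z \<in> insert r (orbit_of g q)" if "z \<in> insert r (orbit_of g q)" for z
      using that y orbit_of_step[of z g q] fx[of z] fp fr by (cases "z = p"; cases "z = r") auto
    then have 2: "orbit_of f q \<subseteq> insert r (orbit_of g q)" by (intro orbit_of_least) auto
    show ?thesis using 1 2 q reach[OF q] unfolding records_def by blast
  qed (auto simp: records_def)
  then show "records n f = {q \<in> records n g. r \<le> q}" by auto
  show "f \<in> endofunctions n" by (rule fE)
qed

text \<open>Reverses the splicing: the cycle predecessor \<open>p\<close> of \<open>r\<close> now
  bypasses it. The new orbit of \<open>r\<close> stays inside the old cycle, whose maximum is
  \<open>r\<close>, so \<open>r\<close> is a record.\<close>

lemma unsplice_cycle_max: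
  assumes f: "f \<in> endofunctions n" and r: "r \<in> cycle_points n f" "\<And>x. x \<in> cycle_points n f \<Longrightarrow> x \<le> r"
    and p: "p \<in> cycle_points n f" "f p = r" "p \<noteq> r"
  defines "g \<equiv> f(p := f r)"
  shows "g \<in> endofunctions n" "cycle_points n g = cycle_points n f - {r}"
    "r \<in> records n g" "g r \<in> cycle_points n g"
proof -
  let ?C = "cycle_points n f"
  note step = cycle_points_step[OF f]
  have V: "r \<in> {1..n}" "p \<in> {1..n}" "f r \<in> {1..n}" using r p step[OF r(1)] cycle_points_subset by blast+
  show gE: "g \<in> endofunctions n" unfolding g_def using f V by (intro endofunctions_upd)
  have gp: "g p = f r" and gr: "g r = f r" and gx: "\<And>x. x \<noteq> p \<Longrightarrow> g x = f x"
    using p by (auto simp: g_def)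
  have inj: "inj_on f ?C" using bij_betw_cycle_points[OF f] by (simp add: bij_betw_def)
  have "f r \<noteq> r" using inj_onD[OF inj, of r p] p r by auto
  have reach: "f r \<in> orbit_of g x" if "x \<in> {1..n}" for x
    using orbit_of_fun_upd[OF cycle_points_orbit[OF step[OF r(1)] that], of p "f r"]
      orbit_of_step[of p g x] gp unfolding g_def[symmetric] by auto
  then have Cg: "cycle_points n g = orbit_of g (f r)" using cycle_points_eq[OF gE V(3)] by blast
  \<comment> \<open>By injectivity on the cycle, \<open>p\<close> is the only cycle point that
    \<open>f\<close> sends to \<open>r\<close>, and \<open>g\<close> redirects it.\<close>
  have "g z \<in> ?C - {r}" if "z \<in> ?C - {r}" for z
  proof (cases "z = p")
    case False
    then have "f z \<noteq> r" using inj_onD[OF inj, of z p] p that by auto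
    then show ?thesis using gx[OF False] step that by auto
  qed (use gp step[OF r(1)] \<open>f r \<noteq> r\<close> in auto)
  then have 1: "orbit_of g (f r) \<subseteq> ?C - {r}"
    using step[OF r(1)] \<open>f r \<noteq> r\<close> by (intro orbit_of_least) auto
  have 2: "?C \<subseteq> insert r (orbit_of g (f r))"
  proof -
    have "f z \<in> insert r (orbit_of g (f r))" if "z \<in> insert r (orbit_of g (f r))" for z
      using that orbit_of_step[of z g "f r"] gx[of z] p(2) by (cases "z = p"; cases "z = r") auto
    then have "orbit_of f r \<subseteq> insert r (orbit_of g (f r))" by (intro orbit_of_least) auto
    then show ?thesis using orbit_of_cycle_point[OF f r(1)] by simp
  qed
  show "cycle_points n g = ?C - {r}" using 1 2 Cg by auto
  show "g r \<in> cycle_points n g" using Cg gr by simp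
  have "orbit_of g r \<subseteq> ?C" using orbit_of_unfold[of g r] gr 1 r by auto
  then show "r \<in> records n g" using V r(2) by (intro recordI) auto
qed

section \<open>Relabelling the points below a record\<close>

definition low_points :: "nat \<Rightarrow> (nat \<Rightarrow> nat) \<Rightarrow> nat \<Rightarrow> nat set" where
  "low_points n g r = {x \<in> {1..n}. orbit_of g x \<subseteq> {..<r}}"

text \<open>On \<open>S\<close> this is the conjugate of \<open>g\<close> by \<open>t\<close>. Edges
  entering \<open>S\<close> from outside keep their targets, so the cycle moves while the image of
  \<open>r\<close> stays fixed.\<close>

definition relabel_low :: "nat \<Rightarrow> (nat \<Rightarrow> nat) \<Rightarrow> nat \<Rightarrow> nat \<Rightarrow> nat" where
  "relabel_low n g r =
     (let S = low_points n g r; t = transpose (g r) (Max S)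
      in (\<lambda>x. if x \<in> S then t (g (t x)) else g x))"

lemma finite_low_points [simp]: "finite (low_points n g r)"
  unfolding low_points_def by auto

lemma low_points_step:
  assumes "g \<in> endofunctions n" "x \<in> low_points n g r"
  shows "g x \<in> low_points n g r"
  using assms endofunctions_range[OF assms(1)] orbit_of_subset[OF orbit_of_step[OF orbit_of_self], of g x]
  unfolding low_points_def by auto

lemma low_points_orbit:
  assumes "g \<in> endofunctions n" "x \<in> low_points n g r"
  shows "orbit_of g x \<subseteq> low_points n g r"
  using assms low_points_step by (intro orbit_of_least)

lemma low_points_less: "x \<in> low_points n g r \<Longrightarrow> x < r"
  unfolding low_points_def using orbit_of_self[of x g] by blast

text \<open>The orbit of the record \<open>r\<close> stays in \<open>{..r}\<close> and contains the
  cycle, which omits \<open>r\<close>. The orbit of \<open>g r\<close> omits \<open>r\<close> as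
  well, since otherwise \<open>r\<close> would be periodic and so on the cycle.\<close>

lemma
  assumes g: "g \<in> endofunctions n" and C: "cycle_points n g \<noteq> {}"
    and r: "r \<in> records n g - cycle_points n g"
  shows cycle_points_low: "cycle_points n g \<subseteq> low_points n g r"
    and image_record_low: "g r \<in> low_points n g r"
    and Max_low: "Max (low_points n g r) \<in> low_points n g r"
proof -
  have rV: "r \<in> {1..n}" using r records_subset by blast
  have le: "orbit_of g r \<subseteq> {..r}" using r record_le by blast
  have "c \<in> low_points n g r" if c: "c \<in> cycle_points n g" for c
  proof -
    have "cycle_points n g \<subseteq> {..r}" using le cycle_points_subset_orbit[OF rV] by blast
    then have "cycle_points n g \<subseteq> {..<r}" using r by (auto simp: order.order_iff_strict)
    then show ?thesis
      using c orbit_of_cycle_point[OF g c] cycle_points_subset unfolding low_points_def by blast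
  qed
  then show "cycle_points n g \<subseteq> low_points n g r" by auto
  have "r \<notin> orbit_of g (g r)" using cycle_point_if_periodic[OF g C rV] r by auto
  moreover have "orbit_of g (g r) \<subseteq> {..r}"
    using le orbit_of_unfold[of g r] by blast
  ultimately have "orbit_of g (g r) \<subseteq> {..<r}" by (auto simp: order.order_iff_strict)
  then show y: "g r \<in> low_points n g r"
    using endofunctions_range[OF g rV] unfolding low_points_def by blast
  show "Max (low_points n g r) \<in> low_points n g r" using y by (intro Max_in) auto
qed

text \<open>A path cannot leave the closed set \<open>S\<close>, so one that ends outside
  \<open>S\<close> never entered it and uses only points where the two maps agree.\<close>

lemma orbit_of_agree_off:
  assumes "z \<in> orbit_of f x" "z \<notin> S"
    and closed: "\<And>w. w \<in> S \<Longrightarrow> f w \<in> S" and eq: "\<And>w. w \<notin> S \<Longrightarrow> h w = f w"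
  shows "z \<in> orbit_of h x"
  using assms(1,2)
proof (induction rule: orbit_of_induct)
  case (step z)
  then have "z \<notin> S" using closed by auto
  then show ?case using step orbit_of_step[of z h x] eq by auto
qed simp

text \<open>Both \<open>g\<close> and \<open>h\<close> map \<open>S\<close> into itself and agree
  outside it. Inside \<open>S\<close> orbits are carried along by \<open>t\<close>; outside
  \<open>S\<close>, where all numbers from \<open>r\<close> upwards lie, every orbit is
  unchanged.\<close>

lemma relabel_low:
  assumes g: "g \<in> endofunctions n" and C: "cycle_points n g \<noteq> {}"
    and r: "r \<in> records n g - cycle_points n g"
  defines "t \<equiv> transpose (g r) (Max (low_points n g r))" and "h \<equiv> relabel_low n g r"
  shows "h \<in> endofunctions n" "cycle_points n h = t ` cycle_points n g"
    "low_points n h r = low_points n g r" "{q \<in> records n h. r \<le> q} = {q \<in> records n g. r \<le> q}"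
    "r \<in> records n h - cycle_points n h" "h r = g r" "relabel_low n h r = g"
proof -
  let ?S = "low_points n g r"
  note CS = cycle_points_low[OF g C r] and yS = image_record_low[OF g C r]
    and MS = Max_low[OF g C r]
  have SV: "?S \<subseteq> {1..n}" by (auto simp: low_points_def)
  have rV: "r \<in> {1..n}" using r records_subset by blast
  have tt [simp]: "t (t x) = x" for x by (simp add: t_def)
  have tS: "t x \<in> ?S \<longleftrightarrow> x \<in> ?S" for x
    using yS MS unfolding t_def by (auto simp: transpose_def)
  have hS: "h x = t (g (t x))" if "x \<in> ?S" for x
    using that by (simp add: h_def relabel_low_def Let_def t_def)
  have hN: "h x = g x" if "x \<notin> ?S" for x
    using that by (simp add: h_def relabel_low_def Let_def)
  have gcl: "g x \<in> ?S" if "x \<in> ?S" for x using low_points_step[OF g that] .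
  have hcl: "h x \<in> ?S" if "x \<in> ?S" for x using that gcl tS hS by auto
  have "h x \<in> {1..n}" if "x \<in> {1..n}" for x
    using endofunctions_range[OF g that] hcl[of x] hN[of x] SV by (cases "x \<in> ?S") auto
  moreover have "h x = undefined" if "x \<notin> {1..n}" for x
  proof -
    have "x \<notin> ?S" using that SV by blast
    then show ?thesis using hN PiE_arb[OF g[unfolded endofunctions_def] that] by simp
  qed
  ultimately show hE: "h \<in> endofunctions n"
    by (auto simp: endofunctions_def PiE_def extensional_def)
  have orb: "orbit_of h x = t ` orbit_of g (t x)" if x: "x \<in> ?S" for x
  proof
    have sub: "orbit_of g (t x) \<subseteq> ?S" using low_points_orbit[OF g] tS x by blast
    show "orbit_of h x \<subseteq> t ` orbit_of g (t x)"
    proof (rule orbit_of_least)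
      show "x \<in> t ` orbit_of g (t x)" by (metis imageI orbit_of_self tt)
      fix z assume "z \<in> t ` orbit_of g (t x)"
      then obtain w where w: "w \<in> orbit_of g (t x)" "z = t w" by auto
      then have "h z = t (g w)" using hS[of z] tS sub by auto
      then show "h z \<in> t ` orbit_of g (t x)" using orbit_of_step[OF w(1)] by auto
    qed
    have "orbit_of g (t x) \<subseteq> {w \<in> ?S. t w \<in> orbit_of h x}"
    proof (rule orbit_of_least)
      show "t x \<in> {w \<in> ?S. t w \<in> orbit_of h x}" using x tS by auto
      fix w assume w: "w \<in> {w \<in> ?S. t w \<in> orbit_of h x}"
      then have "t (g w) = h (t w)" using hS[of "t w"] tS by auto
      then show "g w \<in> {w \<in> ?S. t w \<in> orbit_of h x}"
        using w gcl orbit_of_step[of "t w" h x] by auto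
    qed
    then show "t ` orbit_of g (t x) \<subseteq> orbit_of h x" by auto
  qed
  have off: "z \<in> orbit_of h x \<longleftrightarrow> z \<in> orbit_of g x" if "z \<notin> ?S" for x z
    using orbit_of_agree_off[of z g x ?S h] orbit_of_agree_off[of z h x ?S g] that gcl hcl hN by auto
  \<comment> \<open>A point outside \<open>S\<close> has some \<open>z >= r\<close> in its
    \<open>g\<close>-orbit. Such a \<open>z\<close> is itself outside \<open>S\<close>, so it
    remains in the \<open>h\<close>-orbit.\<close>
  have less: "orbit_of h x \<subseteq> {..<r} \<longleftrightarrow> x \<in> ?S" if x: "x \<in> {1..n}" for x
  proof (cases "x \<in> ?S")
    case True
    then have "orbit_of h x \<subseteq> ?S" using hcl by (intro orbit_of_least)
    then show ?thesis using True low_points_less by auto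
  next
    case False
    then obtain z where "z \<in> orbit_of g x" "z \<ge> r" using x by (force simp: low_points_def)
    then have "z \<in> orbit_of h x" using off low_points_less[of z n g r] by force
    then show ?thesis using \<open>z \<ge> r\<close> False by auto
  qed
  show low: "low_points n h r = ?S"
    unfolding low_points_def[of n h] using less SV by blast
  \<comment> \<open>Until it enters \<open>S\<close>, an \<open>h\<close>-orbit follows
    \<open>g\<close>, which must reach the cycle inside \<open>S\<close>. From the entry point
    \<open>s\<close> on, conjugation by \<open>t\<close> applies.\<close>
  have reach: "t c \<in> orbit_of h x" if x: "x \<in> {1..n}" and c: "c \<in> cycle_points n g" for x c
  proof -
    have "orbit_of h x \<inter> ?S \<noteq> {}"
    proof
      assume e: "orbit_of h x \<inter> ?S = {}"
      then have "g z \<in> orbit_of h x" if "z \<in> orbit_of h x" for z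
        using that hN[of z] orbit_of_step[OF that] e by (metis disjoint_iff)
      then have "orbit_of g x \<subseteq> orbit_of h x" by (intro orbit_of_least) auto
      then show False using e cycle_points_orbit[OF c x] CS c by blast
    qed
    then obtain s where s: "s \<in> orbit_of h x" "s \<in> ?S" by auto
    then have "t s \<in> {1..n}" using tS SV by blast
    then have "t c \<in> orbit_of h s" using orb[OF s(2)] cycle_points_orbit[OF c] by auto
    then show ?thesis using orbit_of_subset[OF s(1)] by auto
  qed
  obtain c where c: "c \<in> cycle_points n g" using C by auto
  have tc: "t c \<in> ?S" using c CS tS by blast
  have "cycle_points n h = orbit_of h (t c)"
    using cycle_points_eq[OF hE _ reach[OF _ c]] tc SV by blast
  then show Ch: "cycle_points n h = t ` cycle_points n g"
    using orb[OF tc] orbit_of_cycle_point[OF g c] by simp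
  \<comment> \<open>Only orbit elements above \<open>q\<close> can spoil a record; as
    \<open>q >= r\<close>, they lie outside \<open>S\<close>, where the orbits coincide.\<close>
  have "q \<in> records n h \<longleftrightarrow> q \<in> records n g" if q: "r \<le> q" for q
  proof -
    have "x \<in> orbit_of h q \<longleftrightarrow> x \<in> orbit_of g q" if "\<not> x \<le> q" for x
      using off[of x q] low_points_less[of x n g r] that q by force
    then show ?thesis unfolding records_def by blast
  qed
  then show rec: "{q \<in> records n h. r \<le> q} = {q \<in> records n g. r \<le> q}" by auto
  have rS: "r \<notin> ?S" using low_points_less by blast
  then have "r \<notin> cycle_points n h" using Ch CS tS by auto
  then show "r \<in> records n h - cycle_points n h" using rec r by auto
  show hr: "h r = g r" using hN[OF rS] .
  \<comment> \<open>\<open>S\<close> and the image of \<open>r\<close> are unchanged, so the second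
    relabelling uses the same involution \<open>t\<close>.\<close>
  show "relabel_low n h r = g"
  proof
    fix x
    show "relabel_low n h r x = g x"
      using hS[of "t x"] hN[of x] tS[of x]
      by (simp add: relabel_low_def[of n h] Let_def low hr flip: t_def)
  qed
qed

section \<open>Counting pairs of an endofunction and a record\<close>

text \<open>The count of records from \<open>r\<close> upwards includes \<open>r\<close> itself. For
  positive \<open>m\<close> the cardinality condition already forces connectedness.\<close>

definition marked_endofunctions :: "nat \<Rightarrow> nat \<Rightarrow> nat \<Rightarrow> ((nat \<Rightarrow> nat) \<times> nat) set" where
  "marked_endofunctions n m k = {(g, r). g \<in> endofunctions n \<and> card (cycle_points n g) = m \<and>
     r \<in> records n g - cycle_points n g \<and> k \<le> card {q \<in> records n g. r \<le> q}}"

text \<open>The new cycle is the image of the old one under the transposition of \<open>g r\<close>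
  and \<open>Max S\<close>, so the two points exchange their membership in the cycle.\<close>

lemma card_marked_swap:
  assumes "m > 0"
  shows "card {(g, r) \<in> marked_endofunctions n m k. Max (low_points n g r) \<in> cycle_points n g}
       = card {(g, r) \<in> marked_endofunctions n m k. g r \<in> cycle_points n g}"
    (is "card ?A = card ?B")
proof -
  let ?F = "\<lambda>(g, r). (relabel_low n g r, r)"
  have *: "?F (g, r) \<in> marked_endofunctions n m k \<and> ?F (?F (g, r)) = (g, r) \<and>
      (relabel_low n g r r \<in> cycle_points n (relabel_low n g r) \<longleftrightarrow>
        Max (low_points n g r) \<in> cycle_points n g) \<and>
      (Max (low_points n (relabel_low n g r) r) \<in> cycle_points n (relabel_low n g r) \<longleftrightarrow>
        g r \<in> cycle_points n g)" if gr: "(g, r) \<in> marked_endofunctions n m k" for g r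
  proof -
    let ?t = "transpose (g r) (Max (low_points n g r))"
    have g: "g \<in> endofunctions n" "cycle_points n g \<noteq> {}" "r \<in> records n g - cycle_points n g"
      using gr assms by (auto simp: marked_endofunctions_def)
    note R = relabel_low[OF g]
    have "card (?t ` cycle_points n g) = card (cycle_points n g)"
      by (rule card_image) simp
    moreover have swap: "x \<in> ?t ` cycle_points n g \<longleftrightarrow> ?t x \<in> cycle_points n g" for x
      using inj_image_mem_iff[OF inj_transpose[of "g r" "Max (low_points n g r)"],
          of "?t x" "cycle_points n g"]
      by (simp only: transpose_involutory)
    moreover have "g r \<in> ?t ` cycle_points n g \<longleftrightarrow> Max (low_points n g r) \<in> cycle_points n g"
      "Max (low_points n g r) \<in> ?t ` cycle_points n g \<longleftrightarrow> g r \<in> cycle_points n g"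
      using swap[of "g r"] swap[of "Max (low_points n g r)"] by simp_all
    ultimately show ?thesis
      using gr R by (simp add: marked_endofunctions_def)
  qed
  have A: "?F x \<in> ?B \<and> ?F (?F x) = x" if "x \<in> ?A" for x
    using that *[of "fst x" "snd x"] by (cases x) simp
  have B: "?F x \<in> ?A \<and> ?F (?F x) = x" if "x \<in> ?B" for x
    using that *[of "fst x" "snd x"] by (cases x) simp
  have "bij_betw ?F ?A ?B"
  proof (rule bij_betw_byWitness[where f' = ?F])
    show "?F ` ?A \<subseteq> ?B" using A by (intro image_subsetI) (rule conjunct1)
    show "?F ` ?B \<subseteq> ?A" using B by (intro image_subsetI) (rule conjunct1)
    show "\<forall>x \<in> ?A. ?F (?F x) = x" using A by (intro ballI) (rule conjunct2)
    show "\<forall>x \<in> ?B. ?F (?F x) = x" using B by (intro ballI) (rule conjunct2)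
  qed
  then show ?thesis by (rule bij_betw_same_card)
qed

text \<open>\<open>F\<close> takes the maximum out of the cycle and marks it; \<open>G\<close>
  splices the marked record back in before its image.\<close>

lemma card_marked_splice:
  assumes "m > 0"
  shows "card {f \<in> endofunctions n. card (cycle_points n f) = m + 1 \<and> k \<le> card (records n f)}
       = card {(g, r) \<in> marked_endofunctions n m k. g r \<in> cycle_points n g}"
    (is "card ?A = card ?B")
proof -
  define pred where "pred f c = inv_into (cycle_points n f) f c" for f c
  define F where "F f = (let r = Max (cycle_points n f) in (f(pred f r := f r), r))" for f
  define G where "G = (\<lambda>(g, r). g(pred g (g r) := r))"
  have 1: "F f \<in> ?B \<and> G (F f) = f" if f: "f \<in> ?A" for f
  proof -
    define r where "r = Max (cycle_points n f)"
    define g where "g = f(pred f r := f r)"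
    have fE: "f \<in> endofunctions n" and card: "card (cycle_points n f) = m + 1"
      and k: "k \<le> card (records n f)" using f by auto
    have rC: "r \<in> cycle_points n f" unfolding r_def using card by (intro Max_in) auto
    have rmax: "x \<le> r" if "x \<in> cycle_points n f" for x using that by (simp add: r_def)
    have p: "pred f r \<in> cycle_points n f" "f (pred f r) = r"
      unfolding pred_def using cycle_pred[OF fE rC] by auto
    \<comment> \<open>A fixed point would be the whole cycle, whose length is
      \<open>m + 1 >= 2\<close>.\<close>
    have pr: "pred f r \<noteq> r"
    proof
      assume e: "pred f r = r"
      then have "orbit_of f r \<subseteq> {r}" using p by (intro orbit_of_least) auto
      then have "card (cycle_points n f) \<le> card {r}"
        using orbit_of_cycle_point[OF fE rC] by (intro card_mono) auto
      then show False using card assms by simp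
    qed
    note U = unsplice_cycle_max[OF fE rC rmax p pr, folded g_def]
    have gp: "g (pred f r) = g r" and gr: "g r = f r" and fg: "g(pred f r := r) = f"
      using pr p by (auto simp: g_def)
    have pC: "pred f r \<in> cycle_points n g" using U(2) p pr by auto
    have rR: "r \<in> records n g - cycle_points n g" using U by auto
    note S = splice_record[OF U(1) rR U(4) pC gp, unfolded fg]
    have "pred g (g r) = pred f r"
      unfolding pred_def[of g] using cycle_pred_eq[OF U(1) pC gp] .
    then have "G (g, r) = f" using fg by (simp add: G_def)
    moreover have "F f = (g, r)" by (simp add: F_def r_def g_def Let_def)
    moreover have "card (cycle_points n g) = m" using U(2) card rC by simp
    ultimately show ?thesis
      using U S(3) rR k by (auto simp: marked_endofunctions_def)
  qed
  have 2: "G (g, r) \<in> ?A \<and> F (G (g, r)) = (g, r)" if gr: "(g, r) \<in> ?B" for g r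
  proof -
    define p where "p = pred g (g r)"
    define f where "f = g(p := r)"
    have g: "g \<in> endofunctions n" "r \<in> records n g - cycle_points n g" "g r \<in> cycle_points n g"
      and card: "card (cycle_points n g) = m" and k: "k \<le> card {q \<in> records n g. r \<le> q}"
      using gr by (auto simp: marked_endofunctions_def)
    have p: "p \<in> cycle_points n g" "g p = g r"
      unfolding p_def pred_def using cycle_pred[OF g(1,3)] by auto
    note S = splice_record[OF g p, folded f_def]
    have rV: "r \<in> {1..n}" using g records_subset by blast
    \<comment> \<open>The cycle lies in the orbit of the record \<open>r\<close>; hence
      \<open>r\<close> is the maximum of the enlarged cycle, and \<open>F\<close> recovers the
      mark.\<close>
    have le: "x \<le> r" if "x \<in> cycle_points n g" for x
      using that g(2) record_le cycle_points_subset_orbit[OF rV] by blast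
    have pr: "p \<noteq> r" using p g by auto
    have max: "Max (cycle_points n f) = r" using S(2) le by (intro Max_eqI) auto
    have "pred f r = p"
      unfolding pred_def using cycle_pred_eq[OF S(1), of p r] S(2) p by (auto simp: f_def)
    moreover have "f(p := f r) = g" using p pr by (auto simp: f_def)
    ultimately have "F f = (g, r)" by (simp add: F_def max Let_def)
    moreover have "G (g, r) = f" by (simp add: G_def f_def p_def)
    moreover have "card (cycle_points n f) = m + 1" using S(2) card g(2) by simp
    ultimately show ?thesis using S k by simp
  qed
  have 2: "G x \<in> ?A \<and> F (G x) = x" if "x \<in> ?B" for x
    using 2[of "fst x" "snd x"] that by (simp only: prod.collapse)
  have "bij_betw F ?A ?B"
  proof (rule bij_betw_byWitness[where f' = G])
    show "F ` ?A \<subseteq> ?B" using 1 by (intro image_subsetI) (rule conjunct1)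
    show "G ` ?B \<subseteq> ?A" using 2 by (intro image_subsetI) (rule conjunct1)
    show "\<forall>f \<in> ?A. G (F f) = f" using 1 by (intro ballI) (rule conjunct2)
    show "\<forall>x \<in> ?B. F (G x) = x" using 2 by (intro ballI) (rule conjunct2)
  qed
  then show ?thesis by (rule bij_betw_same_card)
qed

section \<open>Records on the cycle and the smallest record off it\<close>

text \<open>The orbit of a cycle point is the whole cycle, so the only record on the cycle is its
  maximum.\<close>

lemma card_records_off_cycle:
  assumes f: "f \<in> endofunctions n" and C: "cycle_points n f \<noteq> {}"
  shows "card (records n f) = card (records n f - cycle_points n f) + 1"
proof -
  have M: "Max (cycle_points n f) \<in> cycle_points n f" using C by (intro Max_in) auto
  have "records n f \<inter> cycle_points n f = {Max (cycle_points n f)}"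
  proof
    show "records n f \<inter> cycle_points n f \<subseteq> {Max (cycle_points n f)}"
    proof
      fix r assume r: "r \<in> records n f \<inter> cycle_points n f"
      then have "Max (cycle_points n f) \<le> r"
        using record_le[of r n f] M orbit_of_cycle_point[OF f, of r] by simp
      moreover have "r \<le> Max (cycle_points n f)" using r by simp
      ultimately show "r \<in> {Max (cycle_points n f)}" by simp
    qed
    have "Max (cycle_points n f) \<in> records n f"
    proof (rule recordI)
      show "Max (cycle_points n f) \<in> {1..n}" using M cycle_points_subset by blast
    qed (use orbit_of_cycle_point[OF f M] in simp)
    then show "{Max (cycle_points n f)} \<subseteq> records n f \<inter> cycle_points n f" using M by simp
  qed
  then show ?thesis
    using card_Int_Diff[of "records n f" "cycle_points n f"] by simp
qed

text \<open>If \<open>Max S\<close> is on the cycle, an off-cycle record \<open>q < r\<close> would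
  lie in \<open>S\<close> and have \<open>Max S\<close> in its orbit, forcing
  \<open>q = Max S\<close>. Conversely \<open>Max S\<close> is a record below \<open>r\<close>, as
  its orbit stays in \<open>S\<close>; minimality of \<open>r\<close> puts it on the cycle.\<close>

lemma Max_low_points_on_cycle_iff:
  assumes f: "f \<in> endofunctions n" and C: "cycle_points n f \<noteq> {}"
    and r: "r \<in> records n f - cycle_points n f"
  shows "Max (low_points n f r) \<in> cycle_points n f \<longleftrightarrow> r = Min (records n f - cycle_points n f)"
proof
  let ?M = "Max (low_points n f r)"
  note MS = Max_low[OF f C r]
  have MV: "?M \<in> {1..n}" using MS by (simp add: low_points_def)
  {
    assume M: "?M \<in> cycle_points n f"
    have "r \<le> q" if q: "q \<in> records n f - cycle_points n f" for q
    proof (rule ccontr)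
      assume "\<not> r \<le> q"
      have qV: "q \<in> {1..n}" using q records_subset by blast
      then have "q \<in> low_points n f r"
        using q record_le[of q n f] \<open>\<not> r \<le> q\<close> unfolding low_points_def by force
      then have "q \<le> ?M" by simp
      moreover have "?M \<le> q" using q record_le cycle_points_orbit[OF M qV] by blast
      ultimately show False using M q by simp
    qed
    then show "r = Min (records n f - cycle_points n f)"
      using r by (intro Min_eqI[symmetric]) auto
  next
    assume rm: "r = Min (records n f - cycle_points n f)"
    have "?M \<in> records n f"
      using MV low_points_orbit[OF f MS] by (intro recordI) auto
    moreover have "?M < r" using MS low_points_less by blast
    ultimately show "?M \<in> cycle_points n f"
      using rm Min_le[of "records n f - cycle_points n f" ?M]
      by (metis Diff_iff finite_Diff finite_records not_le)
  }
qed

text \<open>The mark is determined by \<open>f\<close> as its smallest off-cycle record, which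
  exists because \<open>k + 1 >= 2\<close> and only one record is on the cycle. That one record
  accounts for the shift from \<open>k + 1\<close> to \<open>k\<close>.\<close>

lemma card_marked_Min:
  assumes "m > 0" "k > 0"
  shows "card {f \<in> endofunctions n. card (cycle_points n f) = m \<and> k + 1 \<le> card (records n f)}
       = card {(g, r) \<in> marked_endofunctions n m k. Max (low_points n g r) \<in> cycle_points n g}"
    (is "card ?A = card ?B")
proof -
  let ?D = "\<lambda>f. records n f - cycle_points n f"
  \<comment> \<open>All cycle points lie below any off-cycle record, so the bound by the minimum
    removes just the record on the cycle.\<close>
  have up: "{q \<in> records n f. Min (?D f) \<le> q} = ?D f"
    if f: "f \<in> endofunctions n" and C: "cycle_points n f \<noteq> {}" and D: "?D f \<noteq> {}" for f
  proof -
    have "Min (?D f) \<in> ?D f" using D by (intro Min_in) auto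
    then show ?thesis
      using cycle_points_low[OF f C] low_points_less by (fastforce intro: Min_le)
  qed
  have B: "?B = {(f, r). f \<in> ?A \<and> r = Min (?D f)}"
  proof -
    have "(f, r) \<in> ?B \<longleftrightarrow> f \<in> ?A \<and> r = Min (?D f)" for f r
    proof (cases "f \<in> endofunctions n \<and> card (cycle_points n f) = m")
      case True
      then have f: "f \<in> endofunctions n" and C: "cycle_points n f \<noteq> {}" using assms by auto
      show ?thesis
      proof (cases "?D f = {}")
        case True
        then show ?thesis
          unfolding marked_endofunctions_def using card_records_off_cycle[OF f C] assms(2)
          by (simp only: mem_Collect_eq case_prod_conv card.empty) auto
      next
        case False
        then have "Min (?D f) \<in> ?D f" by (intro Min_in) auto
        then show ?thesis
          using True Max_low_points_on_cycle_iff[OF f C, of r] up[OF f C False]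
            card_records_off_cycle[OF f C]
          unfolding marked_endofunctions_def
          by (cases "r = Min (?D f)") auto
      qed
    qed (auto simp: marked_endofunctions_def)
    then show ?thesis by auto
  qed
  have "bij_betw (\<lambda>f. (f, Min (?D f))) ?A ?B"
    unfolding B by (rule bij_betw_byWitness[where f' = fst]) auto
  then show ?thesis by (rule bij_betw_same_card)
qed

section \<open>Connectedness and girth of the functional graph\<close>

lemma functional_graph_simps [simp]:
  "pverts (functional_graph n f) = {1..n}"
  "e \<in> parcs (functional_graph n f) \<longleftrightarrow> fst e \<in> {1..n} \<and> snd e = f (fst e)"
  by (cases e, auto simp: functional_graph_def)+

lemma wf_functional_graph:
  assumes "f \<in> endofunctions n"
  shows "pair_wf_digraph (functional_graph n f)"
  by unfold_locales (use endofunctions_range[OF assms] in auto)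

lemma functional_graph_reachable:
  assumes f: "f \<in> endofunctions n" and x: "x \<in> {1..n}" and y: "y \<in> orbit_of f x"
  shows "x \<rightarrow>\<^sup>*\<^bsub>with_proj (functional_graph n f)\<^esub> y"
proof -
  interpret pair_wf_digraph "functional_graph n f" by (rule wf_functional_graph[OF f])
  show ?thesis using y
  proof (induction rule: orbit_of_induct)
    case self
    show ?case by (rule reachable_refl) (use x in simp)
  next
    case (step z)
    have "z \<in> {1..n}" using endofunctions_orbit[OF f x] step by blast
    then have "z \<rightarrow>\<^bsub>with_proj (functional_graph n f)\<^esub> f z" by simp
    then show ?case by (rule wf_digraph.reachable_adj_trans[OF wf_digraph_axioms step.IH])
  qed
qed

text \<open>Connectedness makes any two orbits meet, and then a point with smallest orbit is reached
  from everywhere. Conversely, all points are joined through a cycle point.\<close>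

lemma connected_functional_graph_iff:
  assumes n: "n > 0" and f: "f \<in> endofunctions n"
  shows "Digraph_Component.connected (with_proj (functional_graph n f)) \<longleftrightarrow> cycle_points n f \<noteq> {}"
proof -
  let ?G = "with_proj (functional_graph n f)"
  interpret G: pair_wf_digraph "functional_graph n f" by (rule wf_functional_graph[OF f])
  interpret S: pair_wf_digraph "mk_symmetric ?G" by (rule G.wellformed_mk_symmetric)
  have V: "verts ?G = {1..n}" by simp
  show ?thesis
  proof
    assume conn: "Digraph_Component.connected ?G"
    have meet: "orbit_of f x \<inter> orbit_of f y \<noteq> {}" if x: "x \<in> {1..n}" and y: "y \<in> {1..n}" for x y
    proof -
      have "x \<rightarrow>\<^sup>*\<^bsub>mk_symmetric ?G\<^esub> y"
        using conn x y V unfolding connected_def strongly_connected_def by simp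
      then show ?thesis
      proof (induction rule: S.reachable_induct)
        case base
        show ?case using orbit_of_unfold[of f x] by simp
      next
        case (step y z)
        then consider "z = f y" | "y = f z"
          by (auto simp: parcs_mk_symmetric)
        then show ?case
        proof cases
          case 1
          obtain w where w: "w \<in> orbit_of f x" "w \<in> orbit_of f y" using step.IH by auto
          show ?thesis
          \<comment> \<open>Passing from \<open>y\<close> to \<open>f y\<close> can lose only
            \<open>y\<close> from the orbit; if the orbits meet at \<open>y\<close> itself, they
            also meet at \<open>f y\<close>.\<close>
          proof (cases "w = y")
            case True
            then have "z \<in> orbit_of f x" using orbit_of_step[OF w(1)] 1 by simp
            then show ?thesis using orbit_of_self[of z f] by auto
          next
            case False
            then have "w \<in> orbit_of f z" using w(2) orbit_of_unfold[of f y] 1 by simp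
            then show ?thesis using w(1) by auto
          qed
        next
          case 2
          then have "orbit_of f y \<subseteq> orbit_of f z" using orbit_of_unfold[of f z] by auto
          then show ?thesis using step.IH by auto
        qed
      qed
    qed
    \<comment> \<open>Any point with a smallest orbit is reached from everywhere.\<close>
    obtain c where c: "c \<in> {1..n}"
      and least: "\<And>x. x \<in> {1..n} \<Longrightarrow> card (orbit_of f c) \<le> card (orbit_of f x)"
      using ex_has_least_nat[of "\<lambda>x. x \<in> {1..n}" 1 "\<lambda>x. card (orbit_of f x)"] n by auto
    have "c \<in> orbit_of f x" if x: "x \<in> {1..n}" for x
    proof -
      obtain w where w: "w \<in> orbit_of f c" "w \<in> orbit_of f x" using meet[OF c x] by auto
      have "finite (orbit_of f c)" using endofunctions_orbit[OF f c] finite_subset by blast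
      moreover have "card (orbit_of f c) \<le> card (orbit_of f w)"
        using endofunctions_orbit[OF f c] w(1) least by blast
      ultimately have "orbit_of f w = orbit_of f c"
        using orbit_of_subset[OF w(1)] by (intro card_seteq)
      then show ?thesis using orbit_of_subset[OF w(2)] orbit_of_self[of c f] by blast
    qed
    then show "cycle_points n f \<noteq> {}" using c unfolding cycle_points_def by blast
  next
    assume "cycle_points n f \<noteq> {}"
    then obtain c where c: "c \<in> cycle_points n f" by auto
    have *: "x \<rightarrow>\<^sup>*\<^bsub>mk_symmetric ?G\<^esub> c" if "x \<in> {1..n}" for x
      using functional_graph_reachable[OF f that cycle_points_orbit[OF c that]]
      by (rule G.reachable_mk_symmetricI)
    have "symmetric (with_proj (mk_symmetric ?G))"
      by (auto simp: symmetric_def sym_def parcs_mk_symmetric)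
    then have "c \<rightarrow>\<^sup>*\<^bsub>mk_symmetric ?G\<^esub> x" if "x \<in> {1..n}" for x
      using symmetric_reachable[OF _ *[OF that]] by blast
    then have "x \<rightarrow>\<^sup>*\<^bsub>mk_symmetric ?G\<^esub> y" if "x \<in> {1..n}" "y \<in> {1..n}" for x y
      using S.reachable_trans[OF *] that by blast
    then show "Digraph_Component.connected ?G"
      using n unfolding connected_def strongly_connected_def by simp
  qed
qed

section \<open>Walks and cycles of the functional graph\<close>

text \<open>Every vertex has a single outgoing edge, so a walk can only follow the orbit of its
  start.\<close>

lemma functional_graph_awalk_subset:
  assumes f: "f \<in> endofunctions n" and p: "pre_digraph.awalk (with_proj (functional_graph n f)) u p v"
  shows "set p \<subseteq> (\<lambda>x. (x, f x)) ` orbit_of f u"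
proof -
  interpret pair_wf_digraph "functional_graph n f" by (rule wf_functional_graph[OF f])
  show ?thesis using p
  proof (induction p arbitrary: u)
    case (Cons e p)
    then have "e = (u, f u)" "awalk (f u) p v"
      by (auto simp: awalk_Cons_iff prod_eq_iff)
    then show ?case using Cons.IH[of "f u"] orbit_of_unfold[of f u] by auto
  qed simp
qed

text \<open>The head of an edge is the tail of the next edge, or the end \<open>v\<close> of the
  walk.\<close>

lemma functional_graph_awalk_closed:
  assumes f: "f \<in> endofunctions n" and p: "pre_digraph.awalk (with_proj (functional_graph n f)) u p v"
    and x: "x \<in> fst ` set p"
  shows "f x \<in> insert v (fst ` set p)"
proof -
  interpret pair_wf_digraph "functional_graph n f" by (rule wf_functional_graph[OF f])
  show ?thesis using p x
  proof (induction p arbitrary: u)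
    case (Cons e p)
    then have e: "e = (u, f u)" "awalk (f u) p v"
      by (auto simp: awalk_Cons_iff prod_eq_iff)
    have "f u \<in> insert v (fst ` set p)"
      using e(2) by (cases p) (auto simp: awalk_simps)
    then show ?case using Cons.IH[OF e(2)] Cons.prems(2) e(1) by auto
  qed simp
qed

text \<open>The tails of a closed walk from \<open>u\<close> form an \<open>f\<close>-closed set,
  hence the orbit of \<open>u\<close>; and \<open>u\<close> is periodic, so that orbit is the cycle.
  This gives the uniqueness behind the definite description in \<open>cycle_edges\<close>.\<close>

lemma functional_graph_cycle_edges:
  assumes f: "f \<in> endofunctions n" and C: "cycle_points n f \<noteq> {}"
    and p: "pre_digraph.cycle (with_proj (functional_graph n f)) p"
  shows "set p = (\<lambda>x. (x, f x)) ` cycle_points n f"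
proof -
  interpret pair_wf_digraph "functional_graph n f" by (rule wf_functional_graph[OF f])
  obtain u where u: "awalk u p u" "p \<noteq> []" using p unfolding cycle_def by auto
  note sub = functional_graph_awalk_subset[OF f u(1)]
  have uV: "u \<in> {1..n}" using u(1) by (auto simp: awalk_def)
  have up: "u \<in> fst ` set p" using u by (cases p) (auto simp: awalk_simps)
  have "orbit_of f u \<subseteq> fst ` set p"
    using functional_graph_awalk_closed[OF f u(1)] up by (intro orbit_of_least) auto
  then have eq: "set p = (\<lambda>x. (x, f x)) ` orbit_of f u" using sub by force
  obtain e q where e: "p = e # q" using u(2) by (cases p) auto
  then have q: "awalk (f u) q u" using u(1) by (auto simp: awalk_Cons_iff prod_eq_iff)
  \<comment> \<open>The last edge of \<open>q\<close> starts in the orbit of \<open>f u\<close> and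
    ends at \<open>u\<close>; if \<open>q\<close> is empty, then \<open>f u = u\<close>.\<close>
  have "u \<in> orbit_of f (f u)"
  proof (cases q rule: rev_cases)
    case Nil
    then show ?thesis using q by (simp add: awalk_Nil_iff)
  next
    case (snoc q' d)
    then have "d \<in> parcs (functional_graph n f)" "snd d = u"
      using q by (auto simp: awalk_simps)
    moreover have "d \<in> (\<lambda>x. (x, f x)) ` orbit_of f (f u)"
      using functional_graph_awalk_subset[OF f q] snoc by auto
    ultimately show ?thesis by (auto dest: orbit_of_step)
  qed
  then have "u \<in> cycle_points n f" by (rule cycle_point_if_periodic[OF f C uV])
  then show ?thesis using eq orbit_of_cycle_point[OF f] by simp
qed

text \<open>A cycle exists because \<open>f c\<close> leads back to \<open>c\<close> and every
  closed walk contains a cycle. Its edges are counted by their tails.\<close>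

lemma endofunction_girth_eq:
  assumes f: "f \<in> endofunctions n" and C: "cycle_points n f \<noteq> {}"
  shows "endofunction_girth n f = card (cycle_points n f)"
proof -
  interpret pair_wf_digraph "functional_graph n f" by (rule wf_functional_graph[OF f])
  obtain c where c: "c \<in> cycle_points n f" using C by auto
  have cV: "c \<in> {1..n}" using c cycle_points_subset by blast
  have fV: "f c \<in> {1..n}" by (rule endofunctions_range[OF f cV])
  obtain q where "awalk (f c) q c"
    using functional_graph_reachable[OF f fV cycle_points_orbit[OF c fV]] reachable_awalk by blast
  then have "awalk c ((c, f c) # q) c"
    using cV by (auto simp: awalk_Cons_iff prod_eq_iff)
  then have "closed_w ((c, f c) # q)" unfolding closed_w_def by auto
  then obtain p where p: "cycle p" using closed_w_imp_cycle by blast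
  have "cycle_edges n f = (\<lambda>x. (x, f x)) ` cycle_points n f"
    unfolding cycle_edges_def
    using p functional_graph_cycle_edges[OF f C] by (intro the_equality) blast+
  then show ?thesis
    unfolding endofunction_girth_def by (simp add: card_image inj_on_def)
qed

text \<open>For positive \<open>m\<close>, having \<open>m\<close> cycle points includes
  connectedness, so the graph notions can be eliminated.\<close>

lemma connected_girth_eq:
  assumes "n > 0" "m > 0"
  shows "{f \<in> connected_endofunctions n. endofunction_girth n f = m \<and> k \<le> card (records n f)}
       = {f \<in> endofunctions n. card (cycle_points n f) = m \<and> k \<le> card (records n f)}"
proof -
  have "f \<in> connected_endofunctions n \<and> endofunction_girth n f = m \<longleftrightarrow>
      f \<in> endofunctions n \<and> card (cycle_points n f) = m" for f
    using connected_functional_graph_iff[OF assms(1)] endofunction_girth_eq assms(2)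
    unfolding connected_endofunctions_def by fastforce
  then show ?thesis by blast
qed

theorem theorem1p3:
  fixes n k m :: nat
  assumes "n > 0" and "k > 0" and "m > 0" and "k \<le> n" and "m \<le> n"
  shows "card {f \<in> connected_endofunctions n.
                 endofunction_girth n f = m \<and> card (records n f) \<ge> k + 1}
       = card {f \<in> connected_endofunctions n.
                 endofunction_girth n f = m + 1 \<and> card (records n f) \<ge> k}"
  using assms card_marked_Min[OF assms(3,2), of n] card_marked_swap[OF assms(3), of n k]
    card_marked_splice[OF assms(3), of n k]
  by (simp add: connected_girth_eq)

end
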